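(* Let $F:X\to K$ be a USCCV multifunction with $K$ compact and $F(X)=\bigcup_{x\in X}F(x)$ dense in $K$, and let $\mu X$ be any compactification of $X$. Then there is a USCCV multifunction $\hat F:\mu X\to K$ with $\hat F\upharpoonright X=F$ and $\hat F(\mu X)=K$. Furthermore, if $F$ is a perfect USCCV multifunction, then $\hat F(\mu X\setminus X)=K\setminus F(X)$.
   Context: Spaces are completely regular. A multifunction $F:X\to\mathcal{P}(Y)$ is USCCV if each $F(x)$ is compact and $\{x:F(x)\cap C\ne\emptyset\}$ is closed for every closed $C\subseteq Y$. For $A\subseteq X$, $F(A)=\bigcup_{a\in A}F(a)$. $F$ is a perfect USCCV multifunction if it is USCCV, closed (images of closed sets are closed), and $\{x:y\in F(x)\}$ is compact for each $y$. *)

theory Defs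
  imports "HOL-Analysis.Analysis"
begin

(* "Completely regular" includes the Hausdorff separation axiom, which the library's
   completely_regular_space does not. *)
definition tychonoff_space :: "'a topology \<Rightarrow> bool" where
  "tychonoff_space X \<longleftrightarrow> completely_regular_space X \<and> Hausdorff_space X"

definition multi_image :: "('a \<Rightarrow> 'b set) \<Rightarrow> 'a set \<Rightarrow> 'b set" where
  "multi_image F A = (\<Union>a\<in>A. F a)"

(* Empty values F x = {} are allowed; values of F outside topspace X are irrelevant. *)
definition usccv :: "'a topology \<Rightarrow> 'b topology \<Rightarrow> ('a \<Rightarrow> 'b set) \<Rightarrow> bool" where
  "usccv X Y F \<longleftrightarrow>
     (\<forall>x\<in>topspace X. compactin Y (F x)) \<and>
     (\<forall>C. closedin Y C \<longrightarrow> closedin X {x \<in> topspace X. F x \<inter> C \<noteq> {}})"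

definition perfect_usccv :: "'a topology \<Rightarrow> 'b topology \<Rightarrow> ('a \<Rightarrow> 'b set) \<Rightarrow> bool" where
  "perfect_usccv X Y F \<longleftrightarrow>
     usccv X Y F \<and>
     (\<forall>A. closedin X A \<longrightarrow> closedin Y (multi_image F A)) \<and>
     (\<forall>y\<in>topspace Y. compactin X {x \<in> topspace X. y \<in> F x})"

definition compactification :: "'a topology \<Rightarrow> 'c topology \<Rightarrow> ('a \<Rightarrow> 'c) \<Rightarrow> bool" where
  "compactification X M e \<longleftrightarrow>
     compact_space M \<and> Hausdorff_space M \<and>
     embedding_map X M e \<and> M closure_of (e ` topspace X) = topspace M"

end

theory Submission
  imports Defs
begin

text \<open>
  The extension is the multifunction whose graph is the closure in \<open>M \<times> K\<close> of the graph of \<open>F\<close>.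
  Since \<open>M\<close> and \<open>K\<close> are compact Hausdorff, every closed subset of \<open>M \<times> K\<close> is the graph of a USCCV
  multifunction and projects onto closed sets, which gives surjectivity.  The closure adds nothing
  over \<open>X\<close> because the graph of a USCCV multifunction into a Hausdorff space is closed in
  \<open>X \<times> K\<close>.  If \<open>F\<close> is perfect, no point of \<open>F(X)\<close> is added over the remainder: the compact fibre
  over such a point is separated from any point of the remainder, and \<open>F\<close> maps closed sets to closed sets.
\<close>

text \<open>\<open>X\<close> lies in \<open>M\<close> only through \<open>e\<close>, so the first
  coordinate is pushed forward along \<open>e\<close>.\<close>

definition multi_graph :: "'a topology \<Rightarrow> ('a \<Rightarrow> 'c) \<Rightarrow> ('a \<Rightarrow> 'b set) \<Rightarrow> ('c \<times> 'b) set" where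
  "multi_graph X e F = {(e x, y) |x y. x \<in> topspace X \<and> y \<in> F x}"

definition closure_extension ::
  "'a topology \<Rightarrow> 'c topology \<Rightarrow> 'b topology \<Rightarrow> ('a \<Rightarrow> 'c) \<Rightarrow> ('a \<Rightarrow> 'b set) \<Rightarrow> 'c \<Rightarrow> 'b set" where
  "closure_extension X M K e F m = {y. (m, y) \<in> prod_topology M K closure_of multi_graph X e F}"

lemma usccv_subset_topspace:
  assumes "usccv X Y F" "x \<in> topspace X"
  shows "F x \<subseteq> topspace Y"
  using assms by (auto simp: usccv_def dest: compactin_subset_topspace)

text \<open>Each value is the preimage of \<open>G\<close> under a slice map, hence closed in the
  compact \<open>K\<close>. The points whose value meets \<open>C\<close> are the projection of the
  compact set \<open>G \<inter> (topspace M \<times> C)\<close>, and compact sets are closed in the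
  Hausdorff space \<open>M\<close>.\<close>

lemma usccv_of_closed_graph:
  assumes M: "compact_space M" "Hausdorff_space M" and K: "compact_space K"
    and G: "closedin (prod_topology M K) G"
  shows "usccv M K (\<lambda>m. {y. (m, y) \<in> G})"
  unfolding usccv_def
proof (intro conjI ballI allI impI)
  have Gsub: "G \<subseteq> topspace M \<times> topspace K"
    using closedin_subset[OF G] by simp
  {
    fix m assume m: "m \<in> topspace M"
    have "continuous_map K (prod_topology M K) (\<lambda>y. (m, y))"
      using m by (simp add: continuous_map_pairwise o_def)
    then have "closedin K {y \<in> topspace K. (m, y) \<in> G}"
      using G by (rule closedin_continuous_map_preimage)
    moreover have "{y \<in> topspace K. (m, y) \<in> G} = {y. (m, y) \<in> G}"
      using Gsub by auto
    ultimately show "compactin K {y. (m, y) \<in> G}"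
      using K closedin_compact_space by metis
  next
    fix C assume C: "closedin K C"
    have "closedin (prod_topology M K) (G \<inter> (topspace M \<times> C))"
      using G C by (simp add: closedin_Int closedin_prod_Times_iff)
    then have "compactin (prod_topology M K) (G \<inter> (topspace M \<times> C))"
      using M(1) K by (simp add: closedin_compact_space compact_space_prod_topology)
    then have "compactin M (fst ` (G \<inter> (topspace M \<times> C)))"
      by (rule image_compactin) (rule continuous_map_fst)
    then have "closedin M (fst ` (G \<inter> (topspace M \<times> C)))"
      using M(2) by (rule compactin_imp_closedin[rotated])
    moreover have "fst ` (G \<inter> (topspace M \<times> C)) = {m \<in> topspace M. {y. (m, y) \<in> G} \<inter> C \<noteq> {}}"
      using Gsub by force
    ultimately show "closedin M {m \<in> topspace M. {y. (m, y) \<in> G} \<inter> C \<noteq> {}}"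
      by simp
  }
qed

text \<open>An open box around \<open>(m, y)\<close> that misses the graph keeps the point out of
  its closure. Both exclusion arguments below come down to finding such a box.\<close>

lemma not_in_closure_extensionI:
  assumes "openin M U" "openin K V" "m \<in> U" "y \<in> V"
    and "\<And>x. x \<in> topspace X \<Longrightarrow> e x \<in> U \<Longrightarrow> F x \<inter> V = {}"
  shows "y \<notin> closure_extension X M K e F m"
proof
  assume "y \<in> closure_extension X M K e F m"
  then have "(m, y) \<in> prod_topology M K closure_of multi_graph X e F"
    by (simp add: closure_extension_def)
  moreover have "openin (prod_topology M K) (U \<times> V)" "(m, y) \<in> U \<times> V"
    using assms(1-4) by (simp_all add: openin_prod_Times_iff)
  ultimately obtain p where "p \<in> multi_graph X e F" "p \<in> U \<times> V"
    unfolding in_closure_of by metis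
  then show False
    using assms(5) by (auto simp: multi_graph_def)
qed

text \<open>The nontrivial inclusion rests on upper semicontinuity: separate the compact
  \<open>F x\<close> from a point \<open>y\<close> outside it; values near \<open>x\<close> stay in
  the neighbourhood of \<open>F x\<close> and so avoid that of \<open>y\<close>.\<close>

lemma closure_extension_embedding:
  assumes K: "Hausdorff_space K" and F: "usccv X K F"
    and e: "embedding_map X M e" and x: "x \<in> topspace X"
  shows "closure_extension X M K e F (e x) = F x"
proof
  have emb: "e ` topspace X \<subseteq> topspace M"
    using homeomorphic_imp_continuous_map[OF e[unfolded embedding_map_def]]
    by (simp add: continuous_map_in_subtopology continuous_map_image_subset_topspace)
  have "multi_graph X e F \<subseteq> topspace (prod_topology M K)"
    using emb usccv_subset_topspace[OF F] by (force simp: multi_graph_def)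
  then have "multi_graph X e F \<subseteq> prod_topology M K closure_of multi_graph X e F"
    by (rule closure_of_subset)
  moreover have "(e x, y) \<in> multi_graph X e F" if "y \<in> F x" for y
    using x that unfolding multi_graph_def by blast
  ultimately show "F x \<subseteq> closure_extension X M K e F (e x)"
    unfolding closure_extension_def by blast
  show "closure_extension X M K e F (e x) \<subseteq> F x"
  proof
    fix y assume y: "y \<in> closure_extension X M K e F (e x)"
    show "y \<in> F x"
    proof (rule ccontr)
      assume "y \<notin> F x"
      have yK: "y \<in> topspace K"
        using y by (auto simp: closure_extension_def in_closure_of)
      have "compactin K (F x)"
        using F x by (simp add: usccv_def)
      then obtain V U where VU: "openin K V" "openin K U" "F x \<subseteq> V" "y \<in> U" "disjnt V U"
        using Hausdorff_space_compact_separation[OF K, of "F x" "{y}"] yK \<open>y \<notin> F x\<close> by auto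
      \<comment> \<open>Upper semicontinuity in its open form: the complement of \<open>W\<close> in
        \<open>X\<close> is the set of points whose value meets the closed set
        \<open>topspace K - V\<close>.\<close>
      define W where "W = {x' \<in> topspace X. F x' \<subseteq> V}"
      have "closedin X {x' \<in> topspace X. F x' \<inter> (topspace K - V) \<noteq> {}}"
        using F VU(1) unfolding usccv_def by blast
      moreover have "W = topspace X - {x' \<in> topspace X. F x' \<inter> (topspace K - V) \<noteq> {}}"
        using usccv_subset_topspace[OF F] by (auto simp: W_def)
      ultimately have "openin X W"
        by (simp add: openin_diff)
      then have "openin (subtopology M (e ` topspace X)) (e ` W)"
        using e homeomorphic_imp_open_map unfolding embedding_map_def open_map_def by blast
      then obtain W' where W': "openin M W'" "e ` W = W' \<inter> e ` topspace X"
        by (auto simp: openin_subtopology)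
      have inj: "inj_on e (topspace X)"
        using e homeomorphic_imp_injective_map unfolding embedding_map_def by blast
      have "y \<notin> closure_extension X M K e F (e x)"
      proof (rule not_in_closure_extensionI[OF W'(1) VU(2) _ VU(4)])
        show "e x \<in> W'"
          using W'(2) x VU(3) by (auto simp: W_def)
      next
        fix x' assume x': "x' \<in> topspace X" "e x' \<in> W'"
        then have "e x' \<in> e ` W" using W'(2) by auto
        then have "x' \<in> W"
          using inj x'(1) by (auto simp: W_def inj_on_def)
        then show "F x' \<inter> U = {}"
          using VU(5) by (auto simp: W_def disjnt_def)
      qed
      then show False using y by simp
    qed
  qed
qed

text \<open>The projection of the closed graph to \<open>K\<close> is compact, hence closed, and it
  contains the dense set \<open>F(X)\<close>.\<close>

lemma closure_extension_surj:
  assumes M: "compact_space M" and K: "compact_space K" "Hausdorff_space K" and F: "usccv X K F"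
    and e: "e ` topspace X \<subseteq> topspace M"
    and dense: "K closure_of (multi_image F (topspace X)) = topspace K"
  shows "multi_image (closure_extension X M K e F) (topspace M) = topspace K"
proof -
  let ?G = "prod_topology M K closure_of multi_graph X e F"
  have Gsub: "?G \<subseteq> topspace M \<times> topspace K"
    using closure_of_subset_topspace[of "prod_topology M K"] by simp
  have eq: "multi_image (closure_extension X M K e F) (topspace M) = snd ` ?G"
    using Gsub by (force simp: multi_image_def closure_extension_def)
  have "compactin (prod_topology M K) ?G"
    using M K by (simp add: closedin_compact_space compact_space_prod_topology)
  then have "compactin K (snd ` ?G)"
    by (rule image_compactin) (rule continuous_map_snd)
  then have cl: "closedin K (snd ` ?G)"
    using K(2) by (rule compactin_imp_closedin[rotated])
  have "multi_graph X e F \<subseteq> topspace (prod_topology M K)"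
    using e usccv_subset_topspace[OF F] by (force simp: multi_graph_def)
  then have "snd ` multi_graph X e F \<subseteq> snd ` ?G"
    by (intro image_mono closure_of_subset)
  moreover have "snd ` multi_graph X e F = multi_image F (topspace X)"
    by (force simp: multi_graph_def multi_image_def)
  ultimately have "topspace K \<subseteq> snd ` ?G"
    using closure_of_minimal[OF _ cl] dense by metis
  then show ?thesis
    using eq closedin_subset[OF cl] by auto
qed

text \<open>
  The closed-image hypothesis covers both readings of perfectness: as a multifunction into \<open>K\<close>,
  and as one into the subspace \<open>F(X)\<close>.
\<close>

lemma closure_extension_remainder_disjoint:
  assumes M: "Hausdorff_space M" and e: "continuous_map X M e"
    and clo: "\<And>A. closedin X A \<Longrightarrow>
      closedin (subtopology K (multi_image F (topspace X))) (multi_image F A)"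
    and fib: "compactin X {x \<in> topspace X. y \<in> F x}"
    and y: "y \<in> topspace K" "y \<in> multi_image F (topspace X)"
    and m: "m \<in> topspace M - e ` topspace X"
  shows "y \<notin> closure_extension X M K e F m"
proof -
  let ?P = "{x \<in> topspace X. y \<in> F x}"
  have "compactin M (e ` ?P)"
    using fib e by (rule image_compactin)
  moreover have "m \<notin> e ` ?P" using m by auto
  ultimately obtain V U where VU: "openin M V" "openin M U" "e ` ?P \<subseteq> V" "m \<in> U" "disjnt V U"
    using Hausdorff_space_compact_separation[OF M, of "e ` ?P" "{m}"] m by auto
  \<comment> \<open>\<open>A\<close> avoids the fibre over \<open>y\<close>, so \<open>y\<close> is
    not in \<open>F(A)\<close>; yet it contains every point that \<open>e\<close> sends into
    \<open>U\<close>.\<close>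
  define A where "A = {x \<in> topspace X. e x \<in> topspace M - V}"
  have "closedin X A"
    unfolding A_def using e VU(1) by (intro closedin_continuous_map_preimage) auto
  \<comment> \<open>\<open>F(A)\<close> is closed only relative to \<open>F(X)\<close>. As
    \<open>y\<close> lies in \<open>F(X)\<close> but not in \<open>F(A)\<close>, it is also outside
    the closed set \<open>T\<close> of \<open>K\<close>.\<close>
  then obtain T where T: "closedin K T" "multi_image F A = T \<inter> multi_image F (topspace X)"
    using clo[of A] by (auto simp: closedin_subtopology)
  have "y \<notin> multi_image F A"
    using VU(3) by (auto simp: multi_image_def A_def)
  then have yT: "y \<in> topspace K - T"
    using T(2) y by blast
  show ?thesis
  proof (rule not_in_closure_extensionI[OF VU(2) _ VU(4) yT])
    show "openin K (topspace K - T)" using T(1) by (simp add: openin_diff)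
  next
    fix x assume x: "x \<in> topspace X" "e x \<in> U"
    then have "x \<in> A"
      using VU(5) openin_subset[OF VU(2)] by (auto simp: A_def disjnt_def)
    then have "F x \<subseteq> T"
      using T(2) by (auto simp: multi_image_def)
    then show "F x \<inter> (topspace K - T) = {}" by auto
  qed
qed

theorem theorem3p14:
  fixes X :: "'a topology" and K :: "'b topology" and M :: "'c topology"
    and F :: "'a \<Rightarrow> 'b set" and e :: "'a \<Rightarrow> 'c"
  assumes "tychonoff_space X"
    and "tychonoff_space K" and "compact_space K"
    and "usccv X K F"
    and "K closure_of (multi_image F (topspace X)) = topspace K"
    and "compactification X M e"
  shows "\<exists>F' :: 'c \<Rightarrow> 'b set.
           usccv M K F' \<and>
           (\<forall>x\<in>topspace X. F' (e x) = F x) \<and>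
           multi_image F' (topspace M) = topspace K \<and>
           (perfect_usccv X K F \<or>
            perfect_usccv X (subtopology K (multi_image F (topspace X))) F \<longrightarrow>
              multi_image F' (topspace M - e ` topspace X)
                = topspace K - multi_image F (topspace X))"
proof -
  let ?F = "closure_extension X M K e F" and ?Y = "multi_image F (topspace X)"
  have K: "compact_space K" "Hausdorff_space K"
    using assms by (auto simp: tychonoff_space_def)
  have M: "compact_space M" "Hausdorff_space M" and emb: "embedding_map X M e"
    using assms by (auto simp: compactification_def)
  have cont: "continuous_map X M e"
    using homeomorphic_imp_continuous_map[OF emb[unfolded embedding_map_def]]
    by (simp add: continuous_map_in_subtopology)
  have usc: "usccv M K ?F"
    using usccv_of_closed_graph[OF M K(1) closedin_closure_of]
    unfolding closure_extension_def[abs_def] .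
  have ext: "?F (e x) = F x" if "x \<in> topspace X" for x
    using closure_extension_embedding[OF K(2) assms(4) emb that] .
  have surj: "multi_image ?F (topspace M) = topspace K"
    using closure_extension_surj[OF M(1) K assms(4) _ assms(5)]
      continuous_map_image_subset_topspace[OF cont] by blast
  have YK: "?Y \<subseteq> topspace K"
    using usccv_subset_topspace[OF assms(4)] by (auto simp: multi_image_def)
  have "multi_image ?F (topspace M - e ` topspace X) = topspace K - ?Y"
    if perf: "perfect_usccv X K F \<or> perfect_usccv X (subtopology K ?Y) F"
  proof
    \<comment> \<open>Perfectness into \<open>K\<close> reduces to the relative form: a closed set
      of \<open>K\<close> inside \<open>F(X)\<close> is closed in that subspace.\<close>
    have clo: "closedin (subtopology K ?Y) (multi_image F A)" if A: "closedin X A" for A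
    proof -
      have "multi_image F A \<subseteq> ?Y"
        using closedin_subset[OF A] by (auto simp: multi_image_def)
      then show ?thesis
        using perf A closedin_subset_topspace unfolding perfect_usccv_def by blast
    qed
    have fib: "compactin X {x \<in> topspace X. y \<in> F x}" if "y \<in> ?Y" for y
      using perf that YK by (auto simp: perfect_usccv_def)
    have "y \<notin> ?F m" if "y \<in> ?Y" "m \<in> topspace M - e ` topspace X" for y m
      using closure_extension_remainder_disjoint[OF M(2) cont clo fib] that YK by blast
    then show "multi_image ?F (topspace M - e ` topspace X) \<subseteq> topspace K - ?Y"
      using surj unfolding multi_image_def by blast
    \<comment> \<open>By surjectivity some \<open>m\<close> takes the value \<open>y\<close>; it
      cannot come from \<open>X\<close>, where the extension agrees with \<open>F\<close>.\<close>
    show "topspace K - ?Y \<subseteq> multi_image ?F (topspace M - e ` topspace X)"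
    proof
      fix y assume y: "y \<in> topspace K - ?Y"
      then obtain m where m: "m \<in> topspace M" "y \<in> ?F m"
        using surj unfolding multi_image_def by blast
      then have "m \<notin> e ` topspace X"
        using y ext unfolding multi_image_def by blast
      then show "y \<in> multi_image ?F (topspace M - e ` topspace X)"
        using m unfolding multi_image_def by blast
    qed
  qed
  then show ?thesis
    using usc ext surj by blast
qed

end
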